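(* Let $s\geq 1$. Two nondegenerate bilinear forms $b$ and $b'$ on $\mathbb K^{s+1}$ correspond to isomorphic graded algebras $\mathcal A(b,2)$ and $\mathcal A(b',2)$ if and only if they belong to the same $GL(s+1,\mathbb K)$-orbit, i.e. if and only if $b'=b\circ L$ for some $L\in GL(s+1,\mathbb K)$.
   Context: $\mathbb K$ is an algebraically closed field of characteristic zero. For $L\in GL(s+1,\mathbb K)$ and a bilinear form $b$ on $\mathbb K^{s+1}$, $(b\circ L)(X,Y)=b(LX,LY)$. For a nondegenerate bilinear form $b$ with components $B_{\mu\nu}=b(e_\mu,e_\nu)$ in the canonical basis $(e_\lambda)_{\lambda\in\{0,\dots,s\}}$ of $\mathbb K^{s+1}$, $\mathcal A(b,2)$ is the quadratic (graded, unital associative) algebra generated by $x^0,\dots,x^s$ in degree 1 with the single relation $\sum_{\mu,\nu}B_{\mu\nu}x^\mu x^\nu=0$. *)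

theory Defs
  imports
    "HOL-Analysis.Cartesian_Space"
    "HOL-Computational_Algebra.Polynomial"
    "HOL-Library.Poly_Mapping"
    "HOL-Algebra.QuotRing"
    "HOL-Algebra.Module"
begin

section \<open>Bilinear forms\<close>

definition bilinear_form :: "(('k::field)^'n \<Rightarrow> 'k^'n \<Rightarrow> 'k) \<Rightarrow> bool" where
  "bilinear_form b \<longleftrightarrow>
     (\<forall>Y. Vector_Spaces.linear (*s) (*) (\<lambda>X. b X Y)) \<and>
     (\<forall>X. Vector_Spaces.linear (*s) (*) (\<lambda>Y. b X Y))"

definition nondegenerate :: "(('k::field)^'n \<Rightarrow> 'k^'n \<Rightarrow> 'k) \<Rightarrow> bool" where
  "nondegenerate b \<longleftrightarrow>
     (\<forall>X. (\<forall>Y. b X Y = 0) \<longrightarrow> X = 0) \<and> (\<forall>Y. (\<forall>X. b X Y = 0) \<longrightarrow> Y = 0)"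

definition form_comp ::
  "(('k::field)^'n \<Rightarrow> 'k^'n \<Rightarrow> 'k) \<Rightarrow> 'k^'n^'n \<Rightarrow> ('k^'n \<Rightarrow> 'k^'n \<Rightarrow> 'k)" (infixl \<open>\<circ>\<^sub>b\<close> 55) where
  "b \<circ>\<^sub>b L = (\<lambda>X Y. b (L *v X) (L *v Y))"

definition form_coeff :: "(('k::field)^'n \<Rightarrow> 'k^'n \<Rightarrow> 'k) \<Rightarrow> 'n \<Rightarrow> 'n \<Rightarrow> 'k" where
  "form_coeff b \<mu> \<nu> = b (axis \<mu> 1) (axis \<nu> 1)"


section \<open>Graded algebras\<close>

text \<open>
  The record only carries the data (ring operations, scalar action of the field type
  \<open>'k\<close>, homogeneous components); no axioms are built in.
\<close>

record ('k, 'a) graded_algebra = "('k, 'a) module" +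
  component :: "nat \<Rightarrow> 'a set"

definition graded_algebra_iso ::
  "('k, 'a, 'm) graded_algebra_scheme \<Rightarrow> ('k, 'c, 'n) graded_algebra_scheme \<Rightarrow> ('a \<Rightarrow> 'c) set" where
  "graded_algebra_iso A B = {\<phi> \<in> ring_iso A B.
     (\<forall>c. \<forall>x \<in> carrier A. \<phi> (c \<odot>\<^bsub>A\<^esub> x) = c \<odot>\<^bsub>B\<^esub> \<phi> x) \<and>
     (\<forall>n. \<phi> ` component A n = component B n)}"

definition isomorphic_graded_algebras ::
  "('k, 'a, 'm) graded_algebra_scheme \<Rightarrow> ('k, 'c, 'n) graded_algebra_scheme \<Rightarrow> bool" where
  "isomorphic_graded_algebras A B \<longleftrightarrow> graded_algebra_iso A B \<noteq> {}"

text \<open>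
  The scalar action on cosets follows the pattern of \<^const>\<open>rcoset_mult\<close>:
  \<open>c \<odot> (I +> x) = I +> (c \<odot> x)\<close>.
\<close>

definition quotient_graded_algebra ::
  "('k, 'a, 'm) graded_algebra_scheme \<Rightarrow> 'a set \<Rightarrow> ('k, 'a set) graded_algebra" where
  "quotient_graded_algebra A I =
     \<lparr>carrier = carrier (A Quot I),
      monoid.mult = monoid.mult (A Quot I),
      one = one (A Quot I),
      zero = zero (A Quot I),
      add = add (A Quot I),
      smult = (\<lambda>c X. \<Union>x\<in>X. I +>\<^bsub>A\<^esub> (c \<odot>\<^bsub>A\<^esub> x)),
      component = (\<lambda>n. (\<lambda>x. I +>\<^bsub>A\<^esub> x) ` component A n)\<rparr>"


section \<open>The free algebra\<close>

text \<open>
  Words over \<open>'n\<close> form a monoid under concatenation, written additively because the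
  convolution product of \<^typ>\<open>'a \<Rightarrow>\<^sub>0 'b\<close> expects an additive monoid of exponents.
  With this instance \<open>'n list \<Rightarrow>\<^sub>0 'k\<close> is the free associative algebra on \<open>'n\<close>.
\<close>

instantiation list :: (type) monoid_add
begin
definition zero_list :: "'a list" where "zero_list = []"
definition plus_list :: "'a list \<Rightarrow> 'a list \<Rightarrow> 'a list" where "plus_list = (@)"
instance by standard (simp_all add: zero_list_def plus_list_def)
end

definition free_scale :: "'k::field \<Rightarrow> ('n list \<Rightarrow>\<^sub>0 'k) \<Rightarrow> ('n list \<Rightarrow>\<^sub>0 'k)" where
  "free_scale c p = Poly_Mapping.map ((*) c) p"

definition free_algebra :: "('k::field, 'n list \<Rightarrow>\<^sub>0 'k) graded_algebra" where
  "free_algebra =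
     \<lparr>carrier = UNIV, monoid.mult = (*), one = 1, zero = 0, add = (+),
      smult = free_scale,
      component = (\<lambda>n. {p. \<forall>w \<in> Poly_Mapping.keys p. length w = n})\<rparr>"

definition gen :: "'n \<Rightarrow> ('n list \<Rightarrow>\<^sub>0 'k::field)" where
  "gen \<mu> = Poly_Mapping.single [\<mu>] 1"


section \<open>The quadratic algebra of a bilinear form\<close>

definition form_relation :: "(('k::field)^'n \<Rightarrow> 'k^'n \<Rightarrow> 'k) \<Rightarrow> ('n list \<Rightarrow>\<^sub>0 'k)" where
  "form_relation b = (\<Sum>\<mu>\<in>UNIV. \<Sum>\<nu>\<in>UNIV. free_scale (form_coeff b \<mu> \<nu>) (gen \<mu> * gen \<nu>))"

text \<open>\<open>Idl\<close> is two-sided: \<^locale>\<open>ideal\<close> requires closure under left and right multiplication.\<close>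

definition form_algebra ::
  "(('k::field)^'n \<Rightarrow> 'k^'n \<Rightarrow> 'k) \<Rightarrow> ('k, ('n list \<Rightarrow>\<^sub>0 'k) set) graded_algebra" where
  "form_algebra b =
     quotient_graded_algebra free_algebra (Idl\<^bsub>free_algebra\<^esub> {form_relation b})"


section \<open>Well-definedness\<close>

lemma lookup_free_scale:
  "Poly_Mapping.lookup (free_scale c p) w = c * Poly_Mapping.lookup p w"
  by (simp add: free_scale_def Poly_Mapping.map.rep_eq when_def)

lemma free_scale_eq: "free_scale c p = Poly_Mapping.single 0 c * p"
proof (induction p rule: update_induct)
  case const
  then show ?case
    by (intro poly_mapping_eqI) (simp add: lookup_free_scale)
next
  case (update p k v)
  have *: "Poly_Mapping.update k v p = Poly_Mapping.single k v + p"
    using update(1) by (intro poly_mapping_eqI)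
      (auto simp: lookup_update lookup_add lookup_single in_keys_iff when_def)
  have "free_scale c (Poly_Mapping.single k v + p)
      = Poly_Mapping.single k (c * v) + free_scale c p"
    by (rule poly_mapping_eqI)
      (simp add: lookup_free_scale lookup_add lookup_single when_def distrib_left)
  with update(3) show ?case by (simp add: * distrib_left mult_single)
qed

lemma ring_free_algebra: "ring (free_algebra :: ('k::field, 'n list \<Rightarrow>\<^sub>0 'k) graded_algebra)"
proof (rule ringI)
  show "abelian_group (free_algebra :: ('k, 'n list \<Rightarrow>\<^sub>0 'k) graded_algebra)"
  proof (rule abelian_groupI)
    fix x :: "'n list \<Rightarrow>\<^sub>0 'k"
    show "\<exists>y\<in>carrier free_algebra. y \<oplus>\<^bsub>free_algebra\<^esub> x = \<zero>\<^bsub>free_algebra\<^esub>"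
      by (rule bexI[of _ "- x"]) (simp_all add: free_algebra_def)
  qed (simp_all add: free_algebra_def ac_simps)
  show "monoid (free_algebra :: ('k, 'n list \<Rightarrow>\<^sub>0 'k) graded_algebra)"
    by (rule monoidI) (simp_all add: free_algebra_def mult.assoc)
qed (simp_all add: free_algebra_def distrib_left distrib_right)

lemma ideal_form_relation: "ideal (Idl\<^bsub>free_algebra\<^esub> {form_relation b}) free_algebra"
  by (rule ring.genideal_ideal[OF ring_free_algebra]) (simp add: free_algebra_def)

lemma ring_form_algebra: "ring (form_algebra b)"
proof -
  let ?Q = "free_algebra Quot (Idl\<^bsub>free_algebra\<^esub> {form_relation b})"
  interpret Q: ring ?Q
    by (rule ideal.quotient_is_ring[OF ideal_form_relation])
  note [simp] = form_algebra_def quotient_graded_algebra_def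
  show ?thesis
  proof (rule ringI)
    show "abelian_group (form_algebra b)"
    proof (rule abelian_groupI)
      fix x assume "x \<in> carrier (form_algebra b)"
      then show "\<exists>y\<in>carrier (form_algebra b). y \<oplus>\<^bsub>form_algebra b\<^esub> x = \<zero>\<^bsub>form_algebra b\<^esub>"
        by (intro bexI[of _ "\<ominus>\<^bsub>?Q\<^esub> x"]) (simp_all add: Q.l_neg)
    qed (simp_all add: Q.a_ac)
    show "monoid (form_algebra b)"
      by (rule monoidI) (simp_all add: Q.m_assoc)
  qed (simp_all add: Q.l_distr Q.r_distr)
qed

lemma smult_form_algebra:
  fixes b :: "('k::field)^'n \<Rightarrow> 'k^'n \<Rightarrow> 'k"
  assumes "I = Idl\<^bsub>free_algebra\<^esub> {form_relation b}"
  shows "c \<odot>\<^bsub>form_algebra b\<^esub> (I +>\<^bsub>free_algebra\<^esub> x) = I +>\<^bsub>free_algebra\<^esub> (c \<odot>\<^bsub>free_algebra\<^esub> x)"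
proof -
  interpret ideal I free_algebra
    using ideal_form_relation assms by simp
  have smult: "c \<odot>\<^bsub>free_algebra\<^esub> y = Poly_Mapping.single 0 c \<otimes>\<^bsub>free_algebra\<^esub> y" for y :: "'n list \<Rightarrow>\<^sub>0 'k"
    by (simp add: free_algebra_def free_scale_eq)
  have coset: "I +>\<^bsub>free_algebra\<^esub> (c \<odot>\<^bsub>free_algebra\<^esub> y) = I +>\<^bsub>free_algebra\<^esub> (c \<odot>\<^bsub>free_algebra\<^esub> x)"
    if y: "y \<in> I +>\<^bsub>free_algebra\<^esub> x" for y
  proof -
    obtain i where i: "i \<in> I" "y = i + x"
      using y by (auto simp: a_r_coset_def' free_algebra_def)
    have "Poly_Mapping.single 0 c \<otimes>\<^bsub>free_algebra\<^esub> i \<in> I"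
      by (rule I_l_closed) (use i in \<open>simp_all add: free_algebra_def\<close>)
    then have "c \<odot>\<^bsub>free_algebra\<^esub> y \<in> I +>\<^bsub>free_algebra\<^esub> (c \<odot>\<^bsub>free_algebra\<^esub> x)"
      unfolding smult i(2) by (auto simp: a_r_coset_def' free_algebra_def distrib_left)
    then show ?thesis
      by (intro a_repr_independence'[symmetric]) (simp_all add: free_algebra_def)
  qed
  have "x \<in> I +>\<^bsub>free_algebra\<^esub> x"
    by (rule a_rcos_self) (simp add: free_algebra_def)
  then have "(\<Union>y \<in> I +>\<^bsub>free_algebra\<^esub> x. I +>\<^bsub>free_algebra\<^esub> (c \<odot>\<^bsub>free_algebra\<^esub> y)) =
      I +>\<^bsub>free_algebra\<^esub> (c \<odot>\<^bsub>free_algebra\<^esub> x)"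
    by (intro SUP_eq_const coset) auto
  then show ?thesis
    unfolding form_algebra_def quotient_graded_algebra_def assms[symmetric] by simp
qed

end

(* An isomorphism of graded algebras is determined by its action on degree 1, where it is given by
   an invertible matrix L because the relations start in degree 2; it is therefore induced by the
   linear substitution x^mu |-> sum_nu L_mu,nu x^nu of the free algebra, which sends the relation
   of b to that of b o L. Since the degree 2 part of the ideal of b' is spanned by its relation,
   b o L = c b' for a scalar c, nonzero by nondegeneracy, and c is absorbed into L by a square
   root of 1/c. Conversely, the substitution given by L and its inverse exchange the ideals of b
   and b o L. *)
theory Submission
  imports Defs
begin

section \<open>Scalars and induction over monomials in the free algebra\<close>

lemma single_add_induct [case_names zero single add]:
  fixes p :: "'a \<Rightarrow>\<^sub>0 'b::monoid_add"
  assumes "P 0" "\<And>w c. P (Poly_Mapping.single w c)" "\<And>p q. P p \<Longrightarrow> P q \<Longrightarrow> P (p + q)"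
  shows "P p"
proof (induction p rule: update_induct)
  case const
  then show ?case by (rule assms(1))
next
  case (update p k v)
  \<comment> \<open>The induction only updates keys outside the support, so the old value at
    \<open>k\<close> is zero and overwriting it amounts to adding a monomial.\<close>
  have "Poly_Mapping.update k v p = Poly_Mapping.single k v + p"
    using update(1) by (intro poly_mapping_eqI)
      (auto simp: lookup_update lookup_add lookup_single in_keys_iff when_def)
  with update(3) show ?case by (simp add: assms)
qed

lemma free_scale_add_right: "free_scale c (p + q) = free_scale c p + free_scale c q"
  by (simp add: free_scale_eq distrib_left)

lemma free_scale_add_left: "free_scale (c + d) p = free_scale c p + free_scale d p"
  by (simp add: free_scale_eq single_add distrib_right)

lemma free_scale_scale: "free_scale c (free_scale d p) = free_scale (c * d) p"
  by (rule poly_mapping_eqI) (simp add: lookup_free_scale mult.assoc)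

lemma free_scale_zero [simp]: "free_scale 0 p = 0" "free_scale c 0 = 0"
  by (simp_all add: free_scale_eq)

lemma free_scale_one [simp]: "free_scale 1 p = p"
  by (simp add: free_scale_eq)

lemma free_scale_sum: "free_scale c (\<Sum>i\<in>A. f i) = (\<Sum>i\<in>A. free_scale c (f i))"
  by (simp add: free_scale_eq sum_distrib_left)

lemma sum_free_scale: "free_scale (\<Sum>i\<in>A. f i) p = (\<Sum>i\<in>A. free_scale (f i) p)"
  by (induction A rule: infinite_finite_induct) (simp_all add: free_scale_add_left)

lemma free_scale_single: "free_scale c (Poly_Mapping.single w d) = Poly_Mapping.single w (c * d)"
  by (simp add: free_scale_eq mult_single)

lemma free_scale_mult_left: "free_scale c p * q = free_scale c (p * q)"
  by (simp add: free_scale_eq mult.assoc)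

text \<open>Scalars act as multiples of the empty word \<open>0\<close>. These are central:
  concatenation with the empty word is neutral on both sides, and the coefficients commute.\<close>

lemma free_scale_mult_right: "p * free_scale c q = free_scale c (p * q)"
proof -
  have "p * Poly_Mapping.single 0 c = Poly_Mapping.single 0 c * p"
    by (induction p rule: single_add_induct)
      (simp_all add: mult_single distrib_left distrib_right mult.commute)
  then show ?thesis by (simp add: free_scale_eq flip: mult.assoc)
qed

section \<open>Coefficients of the quadratic relation\<close>

lemma gen_mult_gen: "gen \<mu> * gen \<nu> = Poly_Mapping.single [\<mu>, \<nu>] 1"
  by (simp add: gen_def mult_single plus_list_def)

text \<open>The products \<open>gen \<mu> * gen \<nu>\<close> are pairwise distinct words, so no two
  terms of the relation merge or cancel. This is how a form is recovered from its relation.\<close>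

lemma lookup_form_relation:
  "Poly_Mapping.lookup (form_relation b) [\<mu>, \<nu>] = form_coeff b \<mu> \<nu>"
proof -
  have "Poly_Mapping.lookup (form_relation b) [\<mu>, \<nu>] =
      (\<Sum>i\<in>UNIV. \<Sum>j\<in>UNIV. if i = \<mu> then (if j = \<nu> then form_coeff b i j else 0) else 0)"
    unfolding form_relation_def lookup_sum
    by (intro sum.cong refl) (auto simp: lookup_free_scale gen_mult_gen lookup_single when_def)
  also have "\<dots> = (\<Sum>i\<in>UNIV. if i = \<mu> then form_coeff b i \<nu> else 0)"
    by (intro sum.cong refl) auto
  finally show ?thesis by simp
qed

lemma length_keys_form_relation:
  assumes "w \<in> Poly_Mapping.keys (form_relation b)"
  shows "length w = 2"
proof (rule ccontr)
  assume "length w \<noteq> 2"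
  then have "Poly_Mapping.lookup (form_relation b) w = 0"
    unfolding form_relation_def lookup_sum
    by (intro sum.neutral ballI) (auto simp: lookup_free_scale gen_mult_gen lookup_single when_def)
  with assms show False by (simp add: in_keys_iff)
qed

section \<open>Elements of degree 1 and linear substitutions\<close>

definition linear_element :: "('k::field)^'n \<Rightarrow> ('n list \<Rightarrow>\<^sub>0 'k)" where
  "linear_element v = (\<Sum>\<mu>\<in>UNIV. free_scale (v $ \<mu>) (gen \<mu>))"

lemma lookup_linear_element: "Poly_Mapping.lookup (linear_element v) [\<mu>] = v $ \<mu>"
proof -
  have "Poly_Mapping.lookup (linear_element v) [\<mu>] = (\<Sum>i\<in>UNIV. if i = \<mu> then v $ i else 0)"
    unfolding linear_element_def lookup_sum
    by (intro sum.cong refl) (simp add: lookup_free_scale gen_def lookup_single when_def)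
  then show ?thesis by simp
qed

lemma linear_element_zero [simp]: "linear_element 0 = 0"
  by (simp add: linear_element_def)

lemma linear_element_axis [simp]: "linear_element (axis \<mu> 1) = gen \<mu>"
proof -
  have "linear_element (axis \<mu> 1) = (\<Sum>i\<in>UNIV. if i = \<mu> then gen i else 0)"
    unfolding linear_element_def by (intro sum.cong refl) (simp add: axis_def)
  then show ?thesis by simp
qed

lemma length_keys_linear_element:
  assumes "w \<in> Poly_Mapping.keys (linear_element v)"
  shows "length w = 1"
proof (rule ccontr)
  assume "length w \<noteq> 1"
  then have "Poly_Mapping.lookup (linear_element v) w = 0"
    unfolding linear_element_def lookup_sum
    by (intro sum.neutral ballI) (auto simp: lookup_free_scale gen_def lookup_single when_def)
  with assms show False by (simp add: in_keys_iff)
qed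

text \<open>A word of length 1 is a single letter, so the coefficients at letters form the vector.
  This turns representatives of degree 1 into matrix rows.\<close>

lemma linear_elementE:
  fixes p :: "'n::finite list \<Rightarrow>\<^sub>0 'k::field"
  assumes "\<And>w. w \<in> Poly_Mapping.keys p \<Longrightarrow> length w = 1"
  obtains v where "p = linear_element v"
proof
  show "p = linear_element (\<chi> \<mu>. Poly_Mapping.lookup p [\<mu>])"
  proof (rule poly_mapping_eqI)
    fix w
    show "Poly_Mapping.lookup p w = Poly_Mapping.lookup (linear_element (\<chi> \<mu>. Poly_Mapping.lookup p [\<mu>])) w"
    proof (cases "length w = 1")
      case True
      then obtain \<mu> where "w = [\<mu>]" by (auto simp: length_Suc_conv)
      then show ?thesis by (simp add: lookup_linear_element)
    next
      case False
      with assms length_keys_linear_element show ?thesis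
        by (metis in_keys_iff)
    qed
  qed
qed

text \<open>The algebra homomorphism provided by the universal property of the free algebra, written
  out in the basis of words. Row \<open>\<mu>\<close> of \<open>L\<close> holds the coefficients of
  the image of the generator \<open>\<mu>\<close>.\<close>

definition linear_subst :: "('k::field)^'n^'m \<Rightarrow> ('m list \<Rightarrow>\<^sub>0 'k) \<Rightarrow> ('n list \<Rightarrow>\<^sub>0 'k)" where
  "linear_subst L p = (\<Sum>w\<in>Poly_Mapping.keys p. free_scale (Poly_Mapping.lookup p w)
     (prod_list (map (\<lambda>\<mu>. linear_element (L $ \<mu>)) w)))"

text \<open>Words outside the support contribute zero. A common index set lets the sums for
  \<open>p\<close>, \<open>q\<close> and \<open>p + q\<close> be compared term by term.\<close>

lemma linear_subst_eq:
  assumes "finite A" "Poly_Mapping.keys p \<subseteq> A"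
  shows "linear_subst L p = (\<Sum>w\<in>A. free_scale (Poly_Mapping.lookup p w)
     (prod_list (map (\<lambda>\<mu>. linear_element (L $ \<mu>)) w)))"
  unfolding linear_subst_def using assms
  by (intro sum.mono_neutral_left) (auto simp: in_keys_iff)

lemma linear_subst_zero [simp]: "linear_subst L 0 = 0"
  by (simp add: linear_subst_def)

lemma linear_subst_add: "linear_subst L (p + q) = linear_subst L p + linear_subst L q"
proof -
  let ?A = "Poly_Mapping.keys p \<union> Poly_Mapping.keys q"
  have "linear_subst L r = (\<Sum>w\<in>?A. free_scale (Poly_Mapping.lookup r w)
      (prod_list (map (\<lambda>\<mu>. linear_element (L $ \<mu>)) w)))" if "Poly_Mapping.keys r \<subseteq> ?A" for r
    using that by (intro linear_subst_eq) auto
  then show ?thesis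
    using keys_add[of p q] by (simp add: lookup_add free_scale_add_left sum.distrib)
qed

lemma linear_subst_sum: "linear_subst L (\<Sum>i\<in>A. f i) = (\<Sum>i\<in>A. linear_subst L (f i))"
  by (induction A rule: infinite_finite_induct) (simp_all add: linear_subst_add)

lemma linear_subst_single:
  "linear_subst L (Poly_Mapping.single w c) =
    free_scale c (prod_list (map (\<lambda>\<mu>. linear_element (L $ \<mu>)) w))"
  by (subst linear_subst_eq[of "{w}"]) simp_all

text \<open>Both sides are additive in each factor, so monomials suffice. There a concatenated word
  yields the product of the two images, and the coefficients can be pulled out because scalars are
  central.\<close>

lemma linear_subst_mult: "linear_subst L (p * q) = linear_subst L p * linear_subst L q"
proof (induction p rule: single_add_induct)
  case (single u c)
  show ?case
    by (induction q rule: single_add_induct)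
      (simp_all add: mult_single linear_subst_single plus_list_def free_scale_mult_left
        free_scale_mult_right free_scale_scale distrib_left linear_subst_add mult.commute)
qed (simp_all add: linear_subst_add distrib_right)

lemma linear_subst_scale: "linear_subst L (free_scale c p) = free_scale c (linear_subst L p)"
  by (induction p rule: single_add_induct)
    (simp_all add: free_scale_single linear_subst_single free_scale_scale
      free_scale_add_right linear_subst_add)

lemma linear_subst_one [simp]: "linear_subst L 1 = 1"
  by (simp add: linear_subst_single zero_list_def flip: single_one)

lemma linear_subst_gen [simp]: "linear_subst L (gen \<mu>) = linear_element (L $ \<mu>)"
  by (simp add: gen_def linear_subst_single)

lemma linear_subst_linear_element:
  "linear_subst L (linear_element v) = linear_element (v v* L)"
proof -
  have "linear_subst L (linear_element v) =
      (\<Sum>\<mu>\<in>UNIV. \<Sum>\<nu>\<in>UNIV. free_scale (v $ \<mu> * L $ \<mu> $ \<nu>) (gen \<nu>))"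
    by (simp add: linear_element_def[of v] linear_subst_sum linear_subst_scale)
      (simp add: linear_element_def free_scale_sum free_scale_scale)
  also have "\<dots> = linear_element (v v* L)"
    by (subst sum.swap) (simp add: linear_element_def vector_matrix_mult_def sum_free_scale)
  finally show ?thesis .
qed

lemma single_Cons: "Poly_Mapping.single (\<mu> # w) c = gen \<mu> * Poly_Mapping.single w c"
  by (simp add: gen_def mult_single plus_list_def)

lemma linear_subst_mat_1 [simp]: "linear_subst (mat 1) p = p"
proof (induction p rule: single_add_induct)
  case (single w c)
  have row: "mat 1 $ \<mu> = axis \<mu> 1" for \<mu> :: 'a
    by (simp add: vec_eq_iff mat_def axis_def eq_commute)
  \<comment> \<open>A word is the product of its letters, each of which is fixed by the identity
    matrix.\<close>
  have "prod_list (map gen w) = Poly_Mapping.single w (1 :: 'b)"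
    proof (induction w)
      case Nil
      show ?case by (simp add: zero_list_def flip: single_one)
    qed (simp add: single_Cons)
  then show ?case by (simp add: linear_subst_single row free_scale_single)
qed (simp_all add: linear_subst_add)

text \<open>Coefficient vectors are rows, so the substitution applied second multiplies on the
  right. Inverse matrices therefore give inverse substitutions.\<close>

lemma linear_subst_linear_subst: "linear_subst L (linear_subst M p) = linear_subst (M ** L) p"
proof (induction p rule: single_add_induct)
  case (single w c)
  have row: "M $ \<mu> v* L = (M ** L) $ \<mu>" for \<mu>
    by (simp add: vec_eq_iff vector_matrix_mult_def matrix_matrix_mult_def)
  have "linear_subst L (prod_list (map (\<lambda>\<mu>. linear_element (M $ \<mu>)) w)) =
      prod_list (map (\<lambda>\<mu>. linear_element ((M ** L) $ \<mu>)) w)"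
    by (induction w) (simp_all add: linear_subst_mult linear_subst_linear_element row)
  then show ?case by (simp add: linear_subst_single linear_subst_scale)
qed (simp_all add: linear_subst_add)

text \<open>Each letter is replaced by a combination of letters, so the image of a word contains
  only words of the same length, and every word in the image of \<open>p\<close> comes from a word
  of \<open>p\<close>.\<close>

lemma length_keys_linear_subst:
  assumes "\<And>w. w \<in> Poly_Mapping.keys p \<Longrightarrow> length w = n"
    and "w \<in> Poly_Mapping.keys (linear_subst L p)"
  shows "length w = n"
proof -
  have len: "length v = length u"
    if "v \<in> Poly_Mapping.keys (prod_list (map (\<lambda>\<mu>. linear_element (L $ \<mu>)) u))" for u v
    using that
  proof (induction u arbitrary: v)
    case Nil
    then show ?case by (simp add: zero_list_def)
  next
    case (Cons \<mu> u)
    then obtain x y where "x \<in> Poly_Mapping.keys (linear_element (L $ \<mu>))"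
      "y \<in> Poly_Mapping.keys (prod_list (map (\<lambda>\<mu>. linear_element (L $ \<mu>)) u))" "v = x + y"
      using keys_mult by fastforce
    with Cons.IH show ?case
      using length_keys_linear_element by (fastforce simp: plus_list_def)
  qed
  have "Poly_Mapping.lookup (linear_subst L p) w \<noteq> 0"
    using assms(2) by (simp add: in_keys_iff)
  then obtain u where "u \<in> Poly_Mapping.keys p" "w \<in> Poly_Mapping.keys
      (free_scale (Poly_Mapping.lookup p u) (prod_list (map (\<lambda>\<mu>. linear_element (L $ \<mu>)) u)))"
    unfolding linear_subst_def lookup_sum by (auto elim: sum.not_neutral_contains_not_neutral simp: in_keys_iff)
  with assms(1) len show ?thesis by (simp add: in_keys_iff lookup_free_scale)
qed

section \<open>Bilinear forms in coordinates and under substitution\<close>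

lemma bilinear_form_sum:
  fixes b :: "('k::field)^'n \<Rightarrow> 'k^'n \<Rightarrow> 'k"
  assumes "bilinear_form b"
  shows "b X Y = (\<Sum>i\<in>UNIV. \<Sum>j\<in>UNIV. X $ i * Y $ j * form_coeff b i j)"
proof -
  interpret l: Vector_Spaces.linear "(*s)" "(*)" "\<lambda>U. b U V" for V
    using assms by (simp add: bilinear_form_def)
  interpret r: Vector_Spaces.linear "(*s)" "(*)" "\<lambda>U. b V U" for V
    using assms by (simp add: bilinear_form_def)
  have "b X Y = b (\<Sum>i\<in>UNIV. X $ i *s axis i 1) (\<Sum>j\<in>UNIV. Y $ j *s axis j 1)"
    by (simp add: basis_expansion)
  also have "\<dots> = (\<Sum>i\<in>UNIV. X $ i * b (axis i 1) (\<Sum>j\<in>UNIV. Y $ j *s axis j 1))"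
    by (simp only: l.sum l.scale)
  also have "\<dots> = (\<Sum>i\<in>UNIV. X $ i * (\<Sum>j\<in>UNIV. Y $ j * b (axis i 1) (axis j 1)))"
    by (simp only: r.sum r.scale)
  finally show ?thesis by (simp add: sum_distrib_left form_coeff_def mult.assoc)
qed

text \<open>If B is the matrix of \<open>b\<close>, both relations have coefficient matrix L^T B L:
  on the left by expanding the product of two rows, on the right because column \<open>k\<close> of
  \<open>L\<close> is the image of the basis vector \<open>k\<close>.\<close>

lemma linear_subst_form_relation:
  fixes L :: "('k::field)^'n^'n"
  assumes "bilinear_form b"
  shows "linear_subst L (form_relation b) = form_relation (b \<circ>\<^sub>b L)"
proof -
  have coeff: "form_coeff (b \<circ>\<^sub>b L) k l =
      (\<Sum>i\<in>UNIV. \<Sum>j\<in>UNIV. L $ i $ k * L $ j $ l * form_coeff b i j)" for k l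
  proof -
    have col: "(L *v axis k 1) $ i = L $ i $ k" for i k
      by (simp add: matrix_vector_mult_def axis_def if_distrib cong: if_cong)
    have "form_coeff (b \<circ>\<^sub>b L) k l = b (L *v axis k 1) (L *v axis l 1)"
      by (simp add: form_coeff_def form_comp_def)
    then show ?thesis
      by (simp add: bilinear_form_sum[OF assms, of "L *v axis k 1"] col)
  qed
  \<comment> \<open>Expanding leaves the indices of \<open>b\<close> outside and those of the new
    words inside; exchanging the two pairs collects the coefficient of each word.\<close>
  have swap: "(\<Sum>i\<in>UNIV. \<Sum>j\<in>UNIV. \<Sum>k\<in>UNIV. \<Sum>l\<in>UNIV. f i j k l) =
      (\<Sum>k\<in>UNIV. \<Sum>l\<in>UNIV. \<Sum>i\<in>UNIV. \<Sum>j\<in>UNIV. f i j k l)"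
    for f :: "'n \<Rightarrow> 'n \<Rightarrow> 'n \<Rightarrow> 'n \<Rightarrow> ('n list \<Rightarrow>\<^sub>0 'k)"
  proof -
    have "(\<Sum>j\<in>UNIV. \<Sum>k\<in>UNIV. \<Sum>l\<in>UNIV. f i j k l) =
        (\<Sum>k\<in>UNIV. \<Sum>l\<in>UNIV. \<Sum>j\<in>UNIV. f i j k l)" for i
      by (subst sum.swap) (intro sum.cong refl sum.swap)
    then have "(\<Sum>i\<in>UNIV. \<Sum>j\<in>UNIV. \<Sum>k\<in>UNIV. \<Sum>l\<in>UNIV. f i j k l) =
        (\<Sum>i\<in>UNIV. \<Sum>k\<in>UNIV. \<Sum>l\<in>UNIV. \<Sum>j\<in>UNIV. f i j k l)"
      by simp
    also have "\<dots> = (\<Sum>k\<in>UNIV. \<Sum>l\<in>UNIV. \<Sum>i\<in>UNIV. \<Sum>j\<in>UNIV. f i j k l)"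
      by (subst sum.swap) (intro sum.cong refl sum.swap)
    finally show ?thesis .
  qed
  have "linear_subst L (form_relation b) = (\<Sum>i\<in>UNIV. \<Sum>j\<in>UNIV. \<Sum>k\<in>UNIV. \<Sum>l\<in>UNIV.
      free_scale (L $ i $ k * L $ j $ l * form_coeff b i j) (gen k * gen l))"
    by (simp add: form_relation_def linear_subst_sum linear_subst_scale linear_subst_mult
        linear_element_def free_scale_sum sum_product free_scale_mult_left free_scale_mult_right
        free_scale_scale mult_ac)
  also have "\<dots> = form_relation (b \<circ>\<^sub>b L)"
    unfolding form_relation_def coeff by (subst swap) (simp add: sum_free_scale)
  finally show ?thesis .
qed

section \<open>The two-sided ideal of the relation and its terms of lowest degree\<close>

abbreviation form_ideal :: "(('k::field)^'n \<Rightarrow> 'k^'n \<Rightarrow> 'k) \<Rightarrow> ('n list \<Rightarrow>\<^sub>0 'k) set" where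
  "form_ideal b \<equiv> Idl\<^bsub>free_algebra\<^esub> {form_relation b}"

abbreviation form_class ::
  "(('k::field)^'n \<Rightarrow> 'k^'n \<Rightarrow> 'k) \<Rightarrow> ('n list \<Rightarrow>\<^sub>0 'k) \<Rightarrow> ('n list \<Rightarrow>\<^sub>0 'k) set" where
  "form_class b p \<equiv> form_ideal b +>\<^bsub>free_algebra\<^esub> p"

lemma free_algebra_simps [simp]:
  "carrier free_algebra = UNIV"
  "p \<otimes>\<^bsub>free_algebra\<^esub> q = p * q"
  "p \<oplus>\<^bsub>free_algebra\<^esub> q = p + q"
  "\<one>\<^bsub>free_algebra\<^esub> = 1"
  "\<zero>\<^bsub>free_algebra\<^esub> = 0"
  "c \<odot>\<^bsub>free_algebra\<^esub> p = free_scale c p"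
  "component free_algebra n = {p. \<forall>w \<in> Poly_Mapping.keys p. length w = n}"
  by (simp_all add: free_algebra_def)

lemma ideal_free_algebraI:
  fixes I :: "('n list \<Rightarrow>\<^sub>0 'k::field) set"
  assumes zero: "0 \<in> I"
    and add: "\<And>p q. p \<in> I \<Longrightarrow> q \<in> I \<Longrightarrow> p + q \<in> I"
    and mult: "\<And>p q. p \<in> I \<Longrightarrow> q * p \<in> I" "\<And>p q. p \<in> I \<Longrightarrow> p * q \<in> I"
  shows "ideal I free_algebra"
proof (rule idealI[OF ring_free_algebra])
  interpret ring "free_algebra :: ('k, 'n list \<Rightarrow>\<^sub>0 'k) graded_algebra"
    by (rule ring_free_algebra)
  show "subgroup I (add_monoid free_algebra)"
  proof (rule add.subgroupI)
    fix p assume "p \<in> I"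
    have "\<ominus>\<^bsub>free_algebra\<^esub> p = - p"
      by (rule minus_equality) simp_all
    \<comment> \<open>Closure under negation is an instance of closure under left
      multiplication.\<close>
    moreover have "- p = (- 1) * p"
      by simp
    ultimately show "\<ominus>\<^bsub>free_algebra\<^esub> p \<in> I"
      using \<open>p \<in> I\<close> mult(1) by metis
  qed (use zero add in auto)
qed (simp_all add: mult)

lemma form_ideal_minimal:
  "ideal I free_algebra \<Longrightarrow> form_relation b \<in> I \<Longrightarrow> form_ideal b \<subseteq> I"
  by (rule ring.genideal_minimal[OF ring_free_algebra]) auto

lemma form_relation_in_form_ideal: "form_relation b \<in> form_ideal b"
  using ring.genideal_self[OF ring_free_algebra, of "{form_relation b}"]
  by simp

lemma form_ideal_closed:
  "0 \<in> form_ideal b"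
  "p \<in> form_ideal b \<Longrightarrow> q \<in> form_ideal b \<Longrightarrow> p + q \<in> form_ideal b"
  "p \<in> form_ideal b \<Longrightarrow> r * p \<in> form_ideal b"
  "p \<in> form_ideal b \<Longrightarrow> p * r \<in> form_ideal b"
proof -
  interpret ideal "form_ideal b" free_algebra
    by (rule ideal_form_relation)
  show "0 \<in> form_ideal b"
    using additive_subgroup.zero_closed[OF ideal.axioms(1)[OF ideal_form_relation]] by simp
  show "p + q \<in> form_ideal b" if "p \<in> form_ideal b" "q \<in> form_ideal b"
    using additive_subgroup.a_closed[OF ideal.axioms(1)[OF ideal_form_relation] that] by simp
  show "r * p \<in> form_ideal b" "p * r \<in> form_ideal b" if "p \<in> form_ideal b"
    using I_l_closed[OF that, of r] I_r_closed[OF that, of r] by simp_all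
qed

text \<open>The \<open>n\<close>-th power of the augmentation ideal, that is, the filtration by the
  shortest word that occurs.\<close>

definition order_ge :: "nat \<Rightarrow> ('n list \<Rightarrow>\<^sub>0 'k::field) set" where
  "order_ge n = {p. \<forall>w \<in> Poly_Mapping.keys p. n \<le> length w}"

lemma order_ge_add: "p \<in> order_ge n \<Longrightarrow> q \<in> order_ge n \<Longrightarrow> p + q \<in> order_ge n"
  using keys_add[of p q] by (auto simp: order_ge_def)

lemma order_ge_mult: "p \<in> order_ge m \<Longrightarrow> q \<in> order_ge n \<Longrightarrow> p * q \<in> order_ge (m + n)"
  using keys_mult[of p q] by (fastforce simp: order_ge_def plus_list_def intro: add_mono)

lemma order_ge_0: "p \<in> order_ge 0"
  by (simp add: order_ge_def)

lemma constant_part: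
  obtains c q where "p = free_scale c 1 + q" "q \<in> order_ge 1"
proof
  let ?c = "Poly_Mapping.lookup p []"
  show "p = free_scale ?c 1 + (p - free_scale ?c 1)"
    by simp
  show "p - free_scale ?c 1 \<in> order_ge 1"
    by (auto simp: order_ge_def in_keys_iff lookup_minus lookup_free_scale lookup_one
        zero_list_def Suc_le_eq)
qed

text \<open>The relation has order 2, so multiplying it on either side by an element without
  constant term lands in order 3. Hence the scalar multiples of the relation modulo order 3 already
  form an ideal, and minimality applies.\<close>

lemma form_ideal_leading_term:
  fixes b :: "('k::field)^'n \<Rightarrow> 'k^'n \<Rightarrow> 'k"
  assumes "p \<in> form_ideal b"
  obtains c h where "p = free_scale c (form_relation b) + h" "h \<in> order_ge 3"
proof -
  let ?r = "form_relation b"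
  let ?I = "{free_scale c ?r + h | c h. h \<in> order_ge 3}"
  have r: "?r \<in> order_ge 2"
    by (simp add: order_ge_def length_keys_form_relation)
  have "ideal ?I free_algebra"
  proof (rule ideal_free_algebraI)
    show "0 \<in> ?I"
      by (intro CollectI exI[of _ 0]) (simp add: order_ge_def)
  next
    fix p q assume "p \<in> ?I" "q \<in> ?I"
    then obtain c h d k where "p = free_scale c ?r + h" "q = free_scale d ?r + k"
      "h \<in> order_ge 3" "k \<in> order_ge 3"
      by blast
    then show "p + q \<in> ?I"
      by (intro CollectI exI[of _ "c + d"] exI[of _ "h + k"])
        (simp add: order_ge_add free_scale_add_left)
  next
    fix p q :: "'n list \<Rightarrow>\<^sub>0 'k"
    assume "p \<in> ?I"
    then obtain c h where p: "p = free_scale c ?r + h" "h \<in> order_ge 3"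
      by blast
    obtain d k where q: "q = free_scale d 1 + k" "k \<in> order_ge 1"
      by (rule constant_part)
    \<comment> \<open>Only the constant \<open>d\<close> of \<open>q\<close> keeps the relation in
      degree 2; all products with \<open>k\<close> or \<open>h\<close> go into the
      remainder.\<close>
    have "q * p = free_scale (d * c) ?r + (k * free_scale c ?r + q * h)"
      by (simp add: p q distrib_left distrib_right free_scale_mult_left free_scale_scale
          free_scale_add_right ac_simps)
    moreover have "k * ?r \<in> order_ge 3" "?r * k \<in> order_ge 3" "q * h \<in> order_ge 3" "h * q \<in> order_ge 3"
      using order_ge_mult[OF q(2) r] order_ge_mult[OF r q(2)]
        order_ge_mult[OF order_ge_0 p(2)] order_ge_mult[OF p(2) order_ge_0]
      by (simp_all add: numeral_3_eq_3)
    moreover have "p * q = free_scale (d * c) ?r + (free_scale c ?r * k + h * q)"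
      by (simp add: p q distrib_left distrib_right free_scale_mult_left free_scale_mult_right free_scale_scale
          free_scale_add_right ac_simps)
    moreover have "free_scale c x \<in> order_ge 3" if "x \<in> order_ge 3" for x :: "'n list \<Rightarrow>\<^sub>0 'k"
      using that by (auto simp: order_ge_def in_keys_iff lookup_free_scale)
    ultimately show "q * p \<in> ?I" "p * q \<in> ?I"
      by (auto simp: free_scale_mult_left free_scale_mult_right intro!: order_ge_add)
  qed
  moreover have "?r \<in> ?I"
    by (intro CollectI exI[of _ 1] exI[of _ 0]) (simp add: order_ge_def)
  ultimately have "p \<in> ?I"
    using form_ideal_minimal assms by blast
  with that show thesis by blast
qed

text \<open>One-letter words occur neither in the relation nor in order 3. So the generators stay
  linearly independent in the quotient.\<close>

lemma linear_element_in_form_ideal: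
  assumes "linear_element v \<in> form_ideal b"
  shows "v = 0"
proof -
  obtain c h where *: "linear_element v = free_scale c (form_relation b) + h" "h \<in> order_ge 3"
    using assms by (rule form_ideal_leading_term)
  have "v $ \<mu> = 0" for \<mu>
  proof -
    have "Poly_Mapping.lookup (form_relation b) [\<mu>] = 0" "Poly_Mapping.lookup h [\<mu>] = 0"
      using length_keys_form_relation[of "[\<mu>]" b] *(2)
      by (auto simp: order_ge_def simp flip: not_in_keys_iff_lookup_eq_zero)
    then show ?thesis
      using arg_cong[OF *(1), of "\<lambda>p. Poly_Mapping.lookup p [\<mu>]"]
      by (simp add: lookup_linear_element lookup_add lookup_free_scale)
  qed
  then show ?thesis by (simp add: vec_eq_iff)
qed

text \<open>The remainder of order 3 has no words of length 2, so comparing coefficients there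
  leaves a multiple of the relation. The scalar may still be zero at this point.\<close>

lemma form_relation_in_form_idealE:
  assumes "form_relation b' \<in> form_ideal b"
  obtains c where "\<And>\<mu> \<nu>. form_coeff b' \<mu> \<nu> = c * form_coeff b \<mu> \<nu>"
proof -
  obtain c h where *: "form_relation b' = free_scale c (form_relation b) + h" "h \<in> order_ge 3"
    using assms by (rule form_ideal_leading_term)
  have "form_coeff b' \<mu> \<nu> = c * form_coeff b \<mu> \<nu>" for \<mu> \<nu>
  proof -
    have "Poly_Mapping.lookup h [\<mu>, \<nu>] = 0"
      using *(2) by (auto simp: order_ge_def simp flip: not_in_keys_iff_lookup_eq_zero)
    then show ?thesis
      using arg_cong[OF *(1), of "\<lambda>p. Poly_Mapping.lookup p [\<mu>, \<nu>]"]
      by (simp add: lookup_form_relation lookup_add lookup_free_scale)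
  qed
  with that show thesis by blast
qed

text \<open>The preimage of an ideal under the substitution homomorphism is an ideal, so it is
  enough to test the generating relation.\<close>

lemma linear_subst_form_ideal:
  assumes "linear_subst L (form_relation b) \<in> form_ideal b'" "p \<in> form_ideal b"
  shows "linear_subst L p \<in> form_ideal b'"
proof -
  have "ideal {p. linear_subst L p \<in> form_ideal b'} free_algebra"
    by (rule ideal_free_algebraI)
      (simp_all add: linear_subst_add linear_subst_mult form_ideal_closed)
  with assms show ?thesis
    using form_ideal_minimal by blast
qed

section \<open>Computing with cosets in the quotient algebra\<close>

lemma form_class_eq: "form_class b p = (\<lambda>i. i + p) ` form_ideal b"
  by (auto simp: a_r_coset_def')

lemma mem_form_class: "p \<in> form_class b p"
  using form_ideal_closed(1) by (force simp: form_class_eq)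

lemma form_algebra_simps:
  "carrier (form_algebra b) = range (form_class b)"
  "form_class b p \<otimes>\<^bsub>form_algebra b\<^esub> form_class b q = form_class b (p * q)"
  "form_class b p \<oplus>\<^bsub>form_algebra b\<^esub> form_class b q = form_class b (p + q)"
  "\<one>\<^bsub>form_algebra b\<^esub> = form_class b 1"
  "\<zero>\<^bsub>form_algebra b\<^esub> = form_ideal b"
  "c \<odot>\<^bsub>form_algebra b\<^esub> form_class b p = form_class b (free_scale c p)"
  "component (form_algebra b) n =
    form_class b ` {p. \<forall>w \<in> Poly_Mapping.keys p. length w = n}"
proof -
  interpret ideal "form_ideal b" free_algebra
    by (rule ideal_form_relation)
  show "carrier (form_algebra b) = range (form_class b)"
    by (auto simp: form_algebra_def quotient_graded_algebra_def FactRing_def A_RCOSETS_def')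
  show "form_class b p \<otimes>\<^bsub>form_algebra b\<^esub> form_class b q = form_class b (p * q)"
    using rcoset_mult_add[of p q]
    by (simp add: form_algebra_def quotient_graded_algebra_def FactRing_def)
  show "form_class b p \<oplus>\<^bsub>form_algebra b\<^esub> form_class b q = form_class b (p + q)"
    using a_rcos_sum[of p q]
    by (simp add: form_algebra_def quotient_graded_algebra_def FactRing_def)
  show "\<one>\<^bsub>form_algebra b\<^esub> = form_class b 1" "\<zero>\<^bsub>form_algebra b\<^esub> = form_ideal b"
    "component (form_algebra b) n =
      form_class b ` {p. \<forall>w \<in> Poly_Mapping.keys p. length w = n}"
    by (simp_all add: form_algebra_def quotient_graded_algebra_def FactRing_def)
  show "c \<odot>\<^bsub>form_algebra b\<^esub> form_class b p = form_class b (free_scale c p)"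
    using smult_form_algebra[OF refl] by simp
qed

lemma form_class_zero: "form_class b 0 = form_ideal b"
  by (simp add: form_class_eq)

section \<open>Invertible matrices and graded isomorphisms\<close>

lemma isomorphic_form_algebra_form_comp:
  fixes L :: "('k::field)^'n^'n"
  assumes "bilinear_form b" "invertible L"
  shows "isomorphic_graded_algebras (form_algebra b) (form_algebra (b \<circ>\<^sub>b L))"
proof -
  obtain M where M: "L ** M = mat 1" "M ** L = mat 1"
    using assms(2) by (auto simp: invertible_def)
  let ?f = "linear_subst L" and ?g = "linear_subst M" and ?b = "b \<circ>\<^sub>b L"
  have fg: "?f (?g p) = p" and gf: "?g (?f p) = p" for p
    by (simp_all add: linear_subst_linear_subst M)
  \<comment> \<open>Inclusions in both directions along mutually inverse maps give equality; this
    serves for the ideals and for the homogeneous components.\<close>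
  have img: "?f ` A = B" if "\<And>p. p \<in> A \<Longrightarrow> ?f p \<in> B" "\<And>p. p \<in> B \<Longrightarrow> ?g p \<in> A" for A B
  proof (intro equalityI subsetI)
    fix p assume "p \<in> B"
    then have "?f (?g p) \<in> ?f ` A"
      using that(2) by blast
    then show "p \<in> ?f ` A"
      by (simp only: fg)
  qed (use that(1) in blast)
  have f_rel: "?f (form_relation b) = form_relation ?b"
    by (rule linear_subst_form_relation[OF assms(1)])
  have g_rel: "?g (form_relation ?b) = form_relation b"
    by (simp add: gf flip: f_rel)
  have "?f p \<in> form_ideal ?b" if "p \<in> form_ideal b" for p
    using that by (rule linear_subst_form_ideal[rotated]) (simp add: f_rel form_relation_in_form_ideal)
  moreover have "?g p \<in> form_ideal b" if "p \<in> form_ideal ?b" for p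
    using that by (rule linear_subst_form_ideal[rotated]) (simp add: g_rel form_relation_in_form_ideal)
  ultimately have ideal: "?f ` form_ideal b = form_ideal ?b"
    by (rule img)
  \<comment> \<open>Since one ideal is mapped exactly onto the other, the image of a coset is a
    whole coset.\<close>
  have cls: "?f ` form_class b p = form_class ?b (?f p)" for p
    unfolding form_class_eq by (simp add: image_image linear_subst_add flip: ideal)
  have "inj ?f"
    by (rule inj_on_inverseI[of _ ?g]) (rule gf)
  then have inj: "inj (image ?f)"
    by (intro injI) (simp add: inj_image_eq_iff)
  have surj: "surj ?f"
    by (rule surjI[of _ ?g]) (rule fg)
  \<comment> \<open>The isomorphism takes a coset, as a set, to its image under the substitution, so
    no representatives have to be chosen.\<close>
  have "image ?f \<in> graded_algebra_iso (form_algebra b) (form_algebra ?b)"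
    unfolding graded_algebra_iso_def
  proof (intro CollectI conjI allI ballI)
    show "image ?f \<in> ring_iso (form_algebra b) (form_algebra ?b)"
    proof (rule ring_iso_memI)
      have "image ?f ` carrier (form_algebra b) = form_class ?b ` range ?f"
        by (simp only: form_algebra_simps image_image cls)
      also have "\<dots> = carrier (form_algebra ?b)"
        by (simp only: surj form_algebra_simps)
      finally show "bij_betw (image ?f) (carrier (form_algebra b)) (carrier (form_algebra ?b))"
        using inj_on_subset[OF inj] by (simp add: bij_betw_def)
    qed (clarsimp simp: form_algebra_simps cls linear_subst_add linear_subst_mult)+
    show "?f ` (c \<odot>\<^bsub>form_algebra b\<^esub> x) = c \<odot>\<^bsub>form_algebra ?b\<^esub> (?f ` x)"
      if "x \<in> carrier (form_algebra b)" for c x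
      using that by (clarsimp simp: form_algebra_simps cls linear_subst_scale)
    show "image ?f ` component (form_algebra b) n = component (form_algebra ?b) n" for n
    proof -
      let ?C = "{p :: 'n list \<Rightarrow>\<^sub>0 'k. \<forall>w \<in> Poly_Mapping.keys p. length w = n}"
      have "?f ` ?C = ?C"
        by (rule img) (auto intro: length_keys_linear_subst)
      moreover have "image ?f ` form_class b ` ?C = form_class ?b ` ?f ` ?C"
        by (simp only: image_image cls)
      ultimately show ?thesis
        by (simp only: form_algebra_simps)
    qed
  qed
  then show ?thesis
    unfolding isomorphic_graded_algebras_def by blast
qed

text \<open>Preservation of degree 1 sends each generator to the class of a linear element, and
  these supply the rows of \<open>L\<close>. Agreement on generators extends to words by
  multiplicativity and to all elements by linearity.\<close>

lemma graded_algebra_iso_form_algebraE: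
  fixes b b' :: "('k::field)^'n \<Rightarrow> 'k^'n \<Rightarrow> 'k"
  assumes iso: "\<phi> \<in> graded_algebra_iso (form_algebra b) (form_algebra b')"
  obtains L :: "'k^'n^'n"
  where "invertible L" "\<And>p. \<phi> (form_class b p) = form_class b' (linear_subst L p)"
proof -
  let ?A = "form_algebra b" and ?B = "form_algebra b'"
  have ring_iso: "\<phi> \<in> ring_iso ?A ?B"
    and smult: "\<And>c x. x \<in> carrier ?A \<Longrightarrow> \<phi> (c \<odot>\<^bsub>?A\<^esub> x) = c \<odot>\<^bsub>?B\<^esub> \<phi> x"
    and comp: "\<And>n. \<phi> ` component ?A n = component ?B n"
    using iso by (auto simp: graded_algebra_iso_def)
  have hom: "\<phi> \<in> ring_hom ?A ?B" and bij: "bij_betw \<phi> (carrier ?A) (carrier ?B)"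
    using ring_iso by (auto simp: ring_iso_def)
  have \<phi>_add: "\<phi> (form_class b (p + q)) = \<phi> (form_class b p) \<oplus>\<^bsub>?B\<^esub> \<phi> (form_class b q)" for p q
    using ring_hom_add[OF hom, of "form_class b p" "form_class b q"]
    by (simp add: form_algebra_simps)
  have \<phi>_mult: "\<phi> (form_class b (p * q)) = \<phi> (form_class b p) \<otimes>\<^bsub>?B\<^esub> \<phi> (form_class b q)" for p q
    using ring_hom_mult[OF hom, of "form_class b p" "form_class b q"]
    by (simp add: form_algebra_simps)
  have \<phi>_scale: "\<phi> (form_class b (free_scale c p)) = c \<odot>\<^bsub>?B\<^esub> \<phi> (form_class b p)" for c p
    using smult[of "form_class b p" c] by (simp add: form_algebra_simps)
  have \<phi>_one: "\<phi> (form_class b 1) = form_class b' 1"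
    using ring_hom_one[OF hom] by (simp add: form_algebra_simps)
  have \<phi>_zero: "\<phi> (form_class b 0) = form_class b' 0"
    using ring_hom_zero[OF hom ring_form_algebra ring_form_algebra]
    by (simp add: form_algebra_simps form_class_zero)
  have "\<exists>v. \<phi> (form_class b (gen \<mu>)) = form_class b' (linear_element v)" for \<mu>
  proof -
    have "form_class b (gen \<mu>) \<in> component ?A 1"
      by (simp add: form_algebra_simps gen_def)
    then have "\<phi> (form_class b (gen \<mu>)) \<in> component ?B 1"
      using comp by blast
    then obtain p where p: "\<phi> (form_class b (gen \<mu>)) = form_class b' p"
      and "\<And>w. w \<in> Poly_Mapping.keys p \<Longrightarrow> length w = 1"
      unfolding form_algebra_simps by blast
    from this(2) obtain v where "p = linear_element v"
      by (rule linear_elementE)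
    with p show ?thesis by blast
  qed
  then obtain l where l: "\<And>\<mu>. \<phi> (form_class b (gen \<mu>)) = form_class b' (linear_element (l \<mu>))"
    by metis
  define L :: "'k^'n^'n" where "L = (\<chi> \<mu>. l \<mu>)"
  have lift: "\<phi> (form_class b p) = form_class b' (linear_subst L p)" for p
  proof (induction p rule: single_add_induct)
    case (single w c)
    have "\<phi> (form_class b (Poly_Mapping.single w 1)) =
        form_class b' (linear_subst L (Poly_Mapping.single w 1))"
    proof (induction w)
      case Nil
      have "Poly_Mapping.single [] 1 = (1 :: 'n list \<Rightarrow>\<^sub>0 'k)"
        by (simp flip: single_one zero_list_def)
      then show ?case by (simp add: \<phi>_one)
    next
      case (Cons \<mu> w)
      then show ?case
        by (simp add: single_Cons \<phi>_mult l linear_subst_mult form_algebra_simps L_def)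
    qed
    then show ?case
      using \<phi>_scale[of c "Poly_Mapping.single w 1"]
        linear_subst_scale[of L c "Poly_Mapping.single w 1"]
      by (simp add: free_scale_single form_algebra_simps)
  qed (simp_all add: \<phi>_zero \<phi>_add linear_subst_add form_algebra_simps)
  \<comment> \<open>A vector killed by the transpose is a row vector killed by \<open>L\<close>. Its
    linear element maps to zero, so by injectivity of \<open>\<phi>\<close> it lies in the ideal,
    which contains no nonzero element of degree 1.\<close>
  have "v = 0" if "transpose L *v v = 0" for v
  proof -
    have "linear_subst L (linear_element v) = 0"
      using that by (simp add: linear_subst_linear_element)
    then have "\<phi> (form_class b (linear_element v)) = \<phi> (form_class b 0)"
      by (simp add: lift)
    then have "form_class b (linear_element v) = form_class b 0"
      by (rule inj_onD[OF bij_betw_imp_inj_on[OF bij]]) (simp_all add: form_algebra_simps)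
    then have "form_class b (linear_element v) = form_ideal b"
      by (simp add: form_class_zero)
    then show "v = 0"
      using mem_form_class[of "linear_element v" b] linear_element_in_form_ideal by simp
  qed
  \<comment> \<open>A trivial kernel gives a left inverse of the transpose, hence a right inverse of
    \<open>L\<close>, which suffices for a square matrix.\<close>
  then have "\<exists>B. B ** transpose L = mat 1"
    unfolding matrix_left_invertible_ker by blast
  then have "invertible L"
    unfolding invertible_right_inverse left_invertible_transpose .
  then show thesis
    by (rule that) (rule lift)
qed

section \<open>Pullback and rescaling of bilinear forms\<close>

lemma bilinear_form_form_comp:
  fixes L :: "('k::field)^'n^'n"
  assumes "bilinear_form b"
  shows "bilinear_form (b \<circ>\<^sub>b L)"
proof -
  have "Vector_Spaces.linear (*s) (*) (\<lambda>X. f (L *v X))" if "Vector_Spaces.linear (*s) (*) f" for f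
    using Vector_Spaces.linear_compose[OF matrix_vector_mul_linear_gen that, of L]
    by (simp add: comp_def)
  note compose = this
  show ?thesis
    unfolding bilinear_form_def form_comp_def
    using assms by (intro conjI allI compose) (simp_all add: bilinear_form_def)
qed

lemma bilinear_form_eq_scale:
  fixes b b' :: "('k::field)^'n \<Rightarrow> 'k^'n \<Rightarrow> 'k"
  assumes "bilinear_form b" "bilinear_form b'"
    and "\<And>\<mu> \<nu>. form_coeff b \<mu> \<nu> = c * form_coeff b' \<mu> \<nu>"
  shows "b X Y = c * b' X Y"
  by (simp add: bilinear_form_sum[OF assms(1)] bilinear_form_sum[OF assms(2)] assms(3)
      sum_distrib_left mult_ac)

lemma bilinear_form_scale:
  fixes b :: "('k::field)^'n \<Rightarrow> 'k^'n \<Rightarrow> 'k"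
  assumes "bilinear_form b"
  shows "b (c *s X) (d *s Y) = c * d * b X Y"
  unfolding bilinear_form_sum[OF assms, of "c *s X"] bilinear_form_sum[OF assms, of X]
  by (simp add: sum_distrib_left mult_ac)

lemma mat_mult_mat: "mat c ** mat d = (mat (c * d) :: ('k::semiring_1)^'n^'n)"
  by (simp add: vec_eq_iff matrix_matrix_mult_def mat_def if_distrib[of "\<lambda>x. x * y" for y] cong: if_cong)

lemma mat_mult_vec: "mat c *v X = (c :: 'k::semiring_1) *s (X :: 'k^'n)"
  by (simp add: vec_eq_iff matrix_vector_mult_def mat_def if_distrib[of "\<lambda>x. x * y" for y] cong: if_cong)

section \<open>Graded isomorphism classes and orbits of nondegenerate forms\<close>

theorem proposition4:
  fixes s :: nat
    and b b' :: "('k::{alg_closed_field, field_char_0})^'n \<Rightarrow> 'k^'n \<Rightarrow> 'k"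
  assumes "s \<ge> 1"
    and "CARD('n) = s + 1"
    and "bilinear_form b" and "nondegenerate b"
    and "bilinear_form b'" and "nondegenerate b'"
  shows "isomorphic_graded_algebras (form_algebra b) (form_algebra b') \<longleftrightarrow>
    (\<exists>L :: 'k^'n^'n. invertible L \<and> b' = b \<circ>\<^sub>b L)"
proof
  assume "\<exists>L :: 'k^'n^'n. invertible L \<and> b' = b \<circ>\<^sub>b L"
  then show "isomorphic_graded_algebras (form_algebra b) (form_algebra b')"
    using isomorphic_form_algebra_form_comp assms(3) by blast
next
  assume "isomorphic_graded_algebras (form_algebra b) (form_algebra b')"
  then obtain \<phi> where \<phi>: "\<phi> \<in> graded_algebra_iso (form_algebra b) (form_algebra b')"
    by (auto simp: isomorphic_graded_algebras_def)
  then obtain L :: "'k^'n^'n" where L: "invertible L"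
    and lift: "\<And>p. \<phi> (form_class b p) = form_class b' (linear_subst L p)"
    by (elim graded_algebra_iso_form_algebraE) blast
  obtain M where M: "L ** M = mat 1"
    using L unfolding invertible_right_inverse by blast
  have bL: "bilinear_form (b \<circ>\<^sub>b L)"
    using assms(3) by (rule bilinear_form_form_comp)
  have "form_class b (form_relation b) = form_class b 0"
  proof -
    interpret ideal "form_ideal b" free_algebra
      by (rule ideal_form_relation)
    show ?thesis
      using a_rcos_const[OF form_relation_in_form_ideal] by (simp add: form_class_zero)
  qed
  \<comment> \<open>The instance \<open>lift[of 0]\<close> expresses that \<open>\<phi>\<close>
    preserves zero, so the vanishing of the relation of \<open>b\<close> in its quotient carries
    over to the target.\<close>
  then have "form_class b' (linear_subst L (form_relation b)) = form_ideal b'"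
    using lift[of 0] lift[of "form_relation b"] by (simp add: form_class_zero)
  then have "form_relation (b \<circ>\<^sub>b L) \<in> form_ideal b'"
    using mem_form_class[of "linear_subst L (form_relation b)" b']
    by (simp add: linear_subst_form_relation[OF assms(3)])
  then obtain c where coeff: "\<And>\<mu> \<nu>. form_coeff (b \<circ>\<^sub>b L) \<mu> \<nu> = c * form_coeff b' \<mu> \<nu>"
    by (elim form_relation_in_form_idealE) blast
  have c: "b (L *v X) (L *v Y) = c * b' X Y" for X Y
    using bilinear_form_eq_scale[OF bL assms(5) coeff, of X Y] by (simp add: form_comp_def)
  \<comment> \<open>If \<open>c\<close> were zero, \<open>b\<close> would vanish on the image of
    \<open>L\<close>, which is everything because \<open>L ** M = mat 1\<close>; this contradicts
    nondegeneracy.\<close>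
  have "c \<noteq> 0"
  proof
    assume "c = 0"
    then have "b X Y = 0" for X Y
      using c[of "M *v X" "M *v Y"] by (simp add: matrix_vector_mul_assoc M)
    then have "X = 0" for X :: "'k^'n"
      using assms(4) by (simp add: nondegenerate_def)
    \<comment> \<open>Any canonical basis vector refutes the claim that all vectors are zero;
      \<open>undefined\<close> merely picks some index.\<close>
    then have "axis undefined 1 = (0 :: 'k^'n)"
      by blast
    then show False
      by simp
  qed
  \<comment> \<open>Scaling \<open>L\<close> by \<open>d\<close> multiplies the pulled back form by
    the square of \<open>d\<close>, so a square root of the inverse of \<open>c\<close> removes the
    factor; it exists over an algebraically closed field.\<close>
  obtain d where d: "d ^ 2 = inverse c"
    using nth_root_exists[of 2 "inverse c"] by auto
  with \<open>c \<noteq> 0\<close> have "d \<noteq> 0"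
    by auto
  have "b' = b \<circ>\<^sub>b (L ** mat d)"
  proof (intro ext)
    fix X Y
    have "(b \<circ>\<^sub>b (L ** mat d)) X Y = b (L *v (d *s X)) (L *v (d *s Y))"
      by (simp add: form_comp_def mat_mult_vec flip: matrix_vector_mul_assoc)
    also have "\<dots> = c * d ^ 2 * b' X Y"
      by (simp add: c bilinear_form_scale[OF assms(5)] power2_eq_square)
    also have "\<dots> = b' X Y"
      using \<open>c \<noteq> 0\<close> by (simp add: d)
    finally show "b' X Y = (b \<circ>\<^sub>b (L ** mat d)) X Y" ..
  qed
  moreover have "invertible (mat d :: 'k^'n^'n)"
    unfolding invertible_right_inverse
    using \<open>d \<noteq> 0\<close> by (intro exI[of _ "mat (inverse d)"]) (simp add: mat_mult_mat)
  ultimately show "\<exists>L :: 'k^'n^'n. invertible L \<and> b' = b \<circ>\<^sub>b L"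
    using L invertible_mult by blast
qed

end
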